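(* Write $L_n(q)=\sum_{k\geq 0}a_{n,k}q^k$. Then the coefficients $a_{n,k}$ are asymptotically normal by a local limit theorem, i.e. $$\lim_{n\to\infty}\sup_{x\in\mathbb{R}}\left|\sigma_n\,p(n,\lfloor \mu_n+x\sigma_n\rfloor)-\frac{1}{\sqrt{2\pi}}e^{-x^2/2}\right|=0,$$ where $p(n,k)=a_{n,k}/\sum_j a_{n,j}$ and $\mu_n$, $\sigma_n^2$ are the mean and variance of the distribution $k\mapsto p(n,k)$.
   Context: Define polynomials $b_n(q)$, $n\geq 1$, by $b_1(q)=1$ and $b_{2n}(q)=b_n(q)$, $b_{4n+1}(q)=q\,b_{2n}(q)+b_{2n+1}(q)$, $b_{4n+3}(q)=b_{2n+1}(q)+q\,b_{2n+2}(q)$ (for all indices for which the right-hand indices are $\geq 1$). For $n\geq 1$ let $L_n(q)=2\left(\sum_{k=1}^{2^n-1}b_k(q)\right)+b_{2^n}(q)$; its coefficients are nonnegative integers. *)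

theory Defs
  imports Complex_Main "HOL-Computational_Algebra.Polynomial"
begin

text \<open>The value at index 0 is a dummy: no index \<open>\<ge> 1\<close> ever refers to it
  (see the recurrences proved below).\<close>

function b_poly :: "nat \<Rightarrow> int poly" where
  "b_poly n =
    (if n = 0 then 0
     else if n = 1 then 1
     else if even n then b_poly (n div 2)
     else if n mod 4 = 1
       then [:0, 1:] * b_poly (2 * (n div 4)) + b_poly (2 * (n div 4) + 1)
     else b_poly (2 * (n div 4) + 1) + [:0, 1:] * b_poly (2 * (n div 4) + 2))"
  by auto
termination
  by (relation "measure id") (simp; presburger)+

declare b_poly.simps [simp del]

lemma b_poly_1: "b_poly 1 = 1"
  by (simp add: b_poly.simps)

lemma b_poly_even:
  assumes "n \<ge> 1"
  shows "b_poly (2 * n) = b_poly n"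
  using assms by (subst b_poly.simps) auto

lemma b_poly_4n1:
  assumes "n \<ge> 1"
  shows "b_poly (4 * n + 1) = [:0, 1:] * b_poly (2 * n) + b_poly (2 * n + 1)"
proof -
  have "(4 * n + 1) mod 4 = 1" "(4 * n + 1) div 4 = n" "odd (4 * n + 1)"
    by presburger+
  then show ?thesis
    using assms by (subst b_poly.simps) auto
qed

lemma b_poly_4n3:
  "b_poly (4 * n + 3) = b_poly (2 * n + 1) + [:0, 1:] * b_poly (2 * n + 2)"
proof -
  have "(4 * n + 3) mod 4 = 3" "(4 * n + 3) div 4 = n" "odd (4 * n + 3)"
    by presburger+
  then show ?thesis
    by (subst b_poly.simps) auto
qed

definition L_poly :: "nat \<Rightarrow> int poly" where
  "L_poly n = 2 * (\<Sum>k = 1..2 ^ n - 1. b_poly k) + b_poly (2 ^ n)"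

text \<open>The second argument is an integer because \<open>\<lfloor>\<mu> + x \<sigma>\<rfloor>\<close> may be negative;
  the coefficients at negative exponents are 0.\<close>

definition L_coeff :: "nat \<Rightarrow> int \<Rightarrow> int" where
  "L_coeff n k = (if k < 0 then 0 else coeff (L_poly n) (nat k))"

definition L_prob :: "nat \<Rightarrow> int \<Rightarrow> real" where
  "L_prob n k = real_of_int (L_coeff n k)
     / real_of_int (\<Sum>j = 0..int (degree (L_poly n)). L_coeff n j)"

definition L_mean :: "nat \<Rightarrow> real" where
  "L_mean n = (\<Sum>k = 0..int (degree (L_poly n)). real_of_int k * L_prob n k)"

definition L_var :: "nat \<Rightarrow> real" where
  "L_var n =
     (\<Sum>k = 0..int (degree (L_poly n)). (real_of_int k - L_mean n)\<^sup>2 * L_prob n k)"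

definition L_sd :: "nat \<Rightarrow> real" where
  "L_sd n = sqrt (L_var n)"

end

theory Submission
  imports Defs "HOL-Probability.Probability"
begin

text \<open>
  The polynomials satisfy \<open>L\<^bsub>n+2\<^esub> = 3 L\<^bsub>n+1\<^esub> + 2 (q - 1) L\<^bsub>n\<^esub>\<close>. This is a disguised Fibonacci (or
  Chebyshev) recurrence, so the zeros are explicit and
  \<open>L\<^bsub>n\<^esub>(q) / 3\<^bsup>n\<^esup> = \<Prod>\<^bsub>1 \<le> j \<le> n/2\<^esub> (1 - p\<^bsub>j\<^esub> + p\<^bsub>j\<^esub> q)\<close> with \<open>p\<^bsub>j\<^esub> = 8/9 cos\<^sup>2 (\<pi> j / (n + 1))\<close>.
  Hence the coefficient distribution is that of a sum of independent Bernoulli variables whose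
  variance \<open>\<Sum> p\<^bsub>j\<^esub> (1 - p\<^bsub>j\<^esub>)\<close> tends to infinity. By Fourier inversion the difference between
  \<open>\<sigma> p(n, k)\<close> and the normal density at \<open>(k - \<mu>) / \<sigma>\<close> is bounded, uniformly in \<open>k\<close>, by the
  \<open>L\<^sup>1\<close> distance between the standardised characteristic function, cut off at \<open>\<bar>t\<bar> \<le> \<pi> \<sigma>\<close>, and
  \<open>exp (- t\<^sup>2 / 2)\<close>; that distance tends to 0 by dominated convergence.
\<close>

section \<open>Local limit theorem for sums of independent Bernoulli variables\<close>

definition bernoulli_gf :: "'a set \<Rightarrow> ('a \<Rightarrow> real) \<Rightarrow> real poly" where
  "bernoulli_gf I p = (\<Prod>j\<in>I. [:1 - p j, p j:])"

text \<open>The expectation of exp(i s (X - p)) for X Bernoulli with parameter p, written as its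
  two-term sum; no probability space is set up.\<close>

definition centred_char :: "real \<Rightarrow> real \<Rightarrow> complex" where
  "centred_char p s = complex_of_real (1 - p) * iexp (- (p * s)) + complex_of_real p * iexp ((1 - p) * s)"

lemma centred_char_eq: "complex_of_real (1 - p) + complex_of_real p * iexp s = iexp (p * s) * centred_char p s"
proof -
  have "iexp (p * s) * iexp (- (p * s)) = 1" "iexp (p * s) * iexp ((1 - p) * s) = iexp s"
    by (simp_all add: algebra_simps flip: exp_add)
  then show ?thesis
    unfolding centred_char_def by (simp add: algebra_simps)
qed

text \<open>The squared modulus equals 1 - 2 p (1 - p) (1 - cos s) exactly, and 1 + u is at most exp
  u.\<close>

lemma norm_centred_char_le:
  "norm (centred_char p s) \<le> exp (- (p * (1 - p) * (1 - cos s)))"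
proof (rule power2_le_imp_le)
  have "norm (centred_char p s) = norm (complex_of_real (1 - p) + complex_of_real p * iexp s)"
    unfolding centred_char_eq norm_mult by simp
  also have "\<dots> ^ 2 = (1 - p + p * cos s)\<^sup>2 + (p * sin s)\<^sup>2"
    by (simp add: cmod_power2 Re_exp Im_exp)
  also have "\<dots> = (1 - p)\<^sup>2 + 2 * (1 - p) * p * cos s + p\<^sup>2 * ((sin s)\<^sup>2 + (cos s)\<^sup>2)"
    by (simp only: power2_eq_square) algebra
  also have "\<dots> = 1 + (- (2 * (p * (1 - p) * (1 - cos s))))"
    unfolding sin_cos_squared_add by (simp add: power2_eq_square algebra_simps)
  also have "\<dots> \<le> exp (- (2 * (p * (1 - p) * (1 - cos s))))"
    by (rule exp_ge_add_one_self)
  also have "\<dots> = (exp (- (p * (1 - p) * (1 - cos s))))\<^sup>2"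
    by (simp flip: exp_double)
  finally show "(norm (centred_char p s))\<^sup>2 \<le> (exp (- (p * (1 - p) * (1 - cos s))))\<^sup>2" .
qed simp

text \<open>Since 1 - cos s = 2 (sin (s/2))^2, a linear lower bound for the sine suffices. For
  \<open>x = s / 2\<close> the cubic Taylor estimate gives |sin x| >= |x| / 3, and 2 (s/6)^2 = s^2 /
  18.\<close>

lemma one_minus_cos_ge:
  fixes s :: real
  assumes "\<bar>s\<bar> \<le> pi"
  shows "s\<^sup>2 / 18 \<le> 1 - cos s"
proof -
  define x where "x = s / 2"
  have x: "\<bar>x\<bar> \<le> 2" using assms pi_less_4 by (simp add: x_def)
  have "\<bar>sin x - x\<bar> \<le> \<bar>x\<bar> ^ 3 / 6"
    using Maclaurin_sin_bound[of x 3] by (simp add: sin_coeff_def eval_nat_numeral)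
  moreover have "\<bar>x\<bar> ^ 3 \<le> 4 * \<bar>x\<bar>"
    using mult_mono[OF x x] by (simp add: power3_eq_cube mult_right_mono)
  ultimately have "\<bar>x\<bar> / 3 \<le> \<bar>sin x\<bar>" by linarith
  then have "(\<bar>x\<bar> / 3)\<^sup>2 \<le> \<bar>sin x\<bar>\<^sup>2" by (rule power_mono) simp
  then show ?thesis
    using cos_double_sin[of x] by (simp add: x_def power_divide)
qed

text \<open>Both functions agree with 1 - v s^2 / 2 to second order, where v = p (1 - p). The errors
  keep the factor v, so that summing over the variables produces the total variance and not their
  number.\<close>

lemma centred_char_approx:
  assumes "0 \<le> p" "p \<le> 1"
  shows "norm (centred_char p s - complex_of_real (exp (- (p * (1 - p) * s\<^sup>2 / 2))))
    \<le> p * (1 - p) * (\<bar>s\<bar> ^ 3 + s ^ 4)"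
proof -
  define v where "v = p * (1 - p)"
  have v: "0 \<le> v" "v \<le> 1"
    using assms mult_mono[of p 1 "1 - p" 1] by (auto simp: v_def)
  define T where "T x = 1 + \<i> * complex_of_real x - complex_of_real (x\<^sup>2 / 2)" for x :: real
  have T: "norm (iexp x - T x) \<le> \<bar>x\<bar> ^ 3" for x
  proof -
    have "norm (iexp x - T x) \<le> \<bar>x\<bar> ^ 3 / 6"
      using iexp_approx1[of x 2] by (simp add: T_def eval_nat_numeral power_mult_distrib algebra_simps)
    also have "\<dots> \<le> \<bar>x\<bar> ^ 3" by simp
    finally show ?thesis .
  qed
  \<comment> \<open>Centring removes the linear term, and the second moment (1 - p) p^2 + p (1 -
    p)^2 is v.\<close>
  have T2: "complex_of_real (1 - p) * T (- (p * s)) + complex_of_real p * T ((1 - p) * s)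
      = complex_of_real (1 - v * s\<^sup>2 / 2)"
    by (simp add: T_def v_def power2_eq_square field_simps)
  have "norm (centred_char p s - complex_of_real (1 - v * s\<^sup>2 / 2))
      = norm (complex_of_real (1 - p) * (iexp (- (p * s)) - T (- (p * s)))
          + complex_of_real p * (iexp ((1 - p) * s) - T ((1 - p) * s)))"
    unfolding T2[symmetric] centred_char_def by (simp add: algebra_simps)
  also have "\<dots> \<le> (1 - p) * \<bar>- (p * s)\<bar> ^ 3 + p * \<bar>(1 - p) * s\<bar> ^ 3"
    using assms
    by (intro order.trans[OF norm_triangle_ineq] add_mono)
       (simp_all only: norm_mult norm_of_real abs_of_nonneg diff_ge_0_iff_ge mult_left_mono T)
  also have "\<dots> = v * \<bar>s\<bar> ^ 3 * (p\<^sup>2 + (1 - p)\<^sup>2)"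
  proof -
    have *: "\<bar>- (p * s)\<bar> = p * \<bar>s\<bar>" "\<bar>(1 - p) * s\<bar> = (1 - p) * \<bar>s\<bar>"
      using assms by (simp_all add: abs_mult)
    have "(1 - p) * (p * u) ^ 3 + p * ((1 - p) * u) ^ 3 = p * (1 - p) * u ^ 3 * (p\<^sup>2 + (1 - p)\<^sup>2)" for u
      by (simp add: eval_nat_numeral algebra_simps)
    then show ?thesis
      unfolding v_def * .
  qed
  also have "\<dots> \<le> v * \<bar>s\<bar> ^ 3 * 1"
  proof (intro mult_left_mono)
    show "p\<^sup>2 + (1 - p)\<^sup>2 \<le> 1"
      using v(1) by (simp add: v_def power2_eq_square algebra_simps)
  qed (use v in simp)
  finally have 1: "norm (centred_char p s - complex_of_real (1 - v * s\<^sup>2 / 2)) \<le> v * \<bar>s\<bar> ^ 3" by simp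
  define y where "y = v * s\<^sup>2 / 2"
  have y: "0 \<le> y" using v by (simp add: y_def)
  have "exp (- y) \<le> 1 / (1 + y)"
    using y exp_ge_add_one_self[of y] by (simp add: exp_minus field_simps)
  \<comment> \<open>Holds because (1 + y) (1 - y + y^2) = 1 + y^3.\<close>
  also have "\<dots> \<le> 1 - y + y\<^sup>2"
    using y by (simp add: field_simps power2_eq_square)
  finally have "\<bar>(1 - y) - exp (- y)\<bar> \<le> y\<^sup>2"
    using exp_ge_add_one_self[of "- y"] by (simp add: abs_if)
  also have "y\<^sup>2 = v * s ^ 4 * (v / 4)"
    by (simp add: y_def power2_eq_square eval_nat_numeral)
  also have "\<dots> \<le> v * s ^ 4 * 1"
    using v by (intro mult_left_mono) auto
  finally have 2: "norm (complex_of_real (1 - y) - complex_of_real (exp (- y))) \<le> v * s ^ 4"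
    unfolding of_real_diff[symmetric] norm_of_real by simp
  have "norm (centred_char p s - complex_of_real (exp (- y))) \<le> v * \<bar>s\<bar> ^ 3 + v * s ^ 4"
    by (rule order.trans[OF norm_diff_triangle_ineq[of _ "complex_of_real (1 - y)" "complex_of_real (1 - y)", simplified]])
       (use 1 2 in \<open>simp add: y_def\<close>)
  then show ?thesis by (simp add: y_def v_def algebra_simps)
qed

section \<open>Convergence of the standardised characteristic functions\<close>

definition bernoulli_sd :: "'a set \<Rightarrow> ('a \<Rightarrow> real) \<Rightarrow> real" where
  "bernoulli_sd I p = sqrt (\<Sum>j\<in>I. p j * (1 - p j))"

definition std_char :: "'a set \<Rightarrow> ('a \<Rightarrow> real) \<Rightarrow> real \<Rightarrow> complex" where
  "std_char I p t = (\<Prod>j\<in>I. centred_char (p j) (t / bernoulli_sd I p))"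

text \<open>The cut-off keeps one full period of exp(i m t / \<sigma>) for integers m, which is the
  range of Fourier inversion on the integers. Extending by 0 puts all integrals on the whole line,
  as dominated convergence requires.\<close>

definition trunc_char :: "'a set \<Rightarrow> ('a \<Rightarrow> real) \<Rightarrow> real \<Rightarrow> complex" where
  "trunc_char I p t =
     indicator {- (pi * bernoulli_sd I p)..pi * bernoulli_sd I p} t *\<^sub>R std_char I p t"

lemma bernoulli_sd_square:
  assumes "\<And>j. j \<in> I \<Longrightarrow> 0 \<le> p j \<and> p j \<le> 1"
  shows "(bernoulli_sd I p)\<^sup>2 = (\<Sum>j\<in>I. p j * (1 - p j))"
  unfolding bernoulli_sd_def using assms by (intro real_sqrt_pow2 sum_nonneg) auto

lemma continuous_centred_char [continuous_intros]:
  "continuous_on A f \<Longrightarrow> continuous_on A (\<lambda>x. centred_char p (f x))"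
  unfolding centred_char_def by (intro continuous_intros)

lemma continuous_std_char: "continuous_on A (std_char I p)"
  unfolding std_char_def divide_inverse by (intro continuous_intros)

lemma measurable_trunc_char [measurable]: "trunc_char I p \<in> borel_measurable borel"
proof -
  have [measurable]: "std_char I p \<in> borel_measurable borel"
    by (intro borel_measurable_continuous_onI continuous_std_char)
  show ?thesis unfolding trunc_char_def by measurable
qed

text \<open>Inside the cut-off |t / \<sigma>| <= pi, so the cosine bound applies to every factor.
  The variances in the exponents add up to \<sigma>^2 and cancel the scaling, which leaves a
  majorant independent of \<sigma>.\<close>

lemma norm_trunc_char_le:
  assumes p: "\<And>j. j \<in> I \<Longrightarrow> 0 \<le> p j \<and> p j \<le> 1" and pos: "bernoulli_sd I p > 0"
  shows "norm (trunc_char I p t) \<le> exp (- (t\<^sup>2 / 18))"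
proof (cases "\<bar>t\<bar> \<le> pi * bernoulli_sd I p")
  case True
  define s where "s = t / bernoulli_sd I p"
  have s: "\<bar>s\<bar> \<le> pi" using True pos by (simp add: s_def field_simps)
  have "norm (trunc_char I p t) \<le> norm (std_char I p t)"
    by (simp add: trunc_char_def indicator_def)
  also have "\<dots> \<le> (\<Prod>j\<in>I. exp (- (p j * (1 - p j) * (1 - cos s))))"
    unfolding std_char_def s_def[symmetric]
    by (simp only: prod_norm[symmetric]) (intro prod_mono, simp add: norm_centred_char_le)
  also have "\<dots> = exp (- ((bernoulli_sd I p)\<^sup>2 * (1 - cos s)))"
    \<comment> \<open>For infinite \<open>I\<close> the sum defaults to 0 and the product to 1, so
      both sides are 1.\<close>
    by (cases "finite I")
       (simp_all add: bernoulli_sd_square[OF p] sum_distrib_right sum_negf flip: exp_sum)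
  also have "\<dots> \<le> exp (- ((bernoulli_sd I p)\<^sup>2 * (s\<^sup>2 / 18)))"
    using one_minus_cos_ge[OF s] by (simp only: exp_le_cancel_iff neg_le_iff_le mult_left_mono zero_le_power2)
  also have "(bernoulli_sd I p)\<^sup>2 * (s\<^sup>2 / 18) = t\<^sup>2 / 18"
    using pos by (simp add: s_def power_divide)
  finally show ?thesis .
qed (auto simp: trunc_char_def indicator_def)

text \<open>The Gaussian splits into one factor per variable because the variances add up to
  \<sigma>^2. For products of numbers in the unit disc, the difference is at most the sum of the
  differences of the factors.\<close>

lemma std_char_approx:
  assumes p: "\<And>j. j \<in> I \<Longrightarrow> 0 \<le> p j \<and> p j \<le> 1" and fin: "finite I"
    and pos: "bernoulli_sd I p > 0"
  shows "norm (std_char I p t - complex_of_real (exp (- (t\<^sup>2 / 2))))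
     \<le> \<bar>t\<bar> ^ 3 / bernoulli_sd I p + t ^ 4 / (bernoulli_sd I p)\<^sup>2"
proof -
  let ?\<sigma> = "bernoulli_sd I p"
  define s where "s = t / ?\<sigma>"
  have sq: "?\<sigma>\<^sup>2 * (s\<^sup>2 / 2) = t\<^sup>2 / 2"
    using pos by (simp add: s_def power_divide)
  have "exp (- (t\<^sup>2 / 2)) = exp (\<Sum>j\<in>I. - (p j * (1 - p j) * s\<^sup>2 / 2))"
    unfolding sq[symmetric] by (simp add: bernoulli_sd_square[OF p] sum_distrib_right sum_negf sum_divide_distrib)
  also have "\<dots> = (\<Prod>j\<in>I. exp (- (p j * (1 - p j) * s\<^sup>2 / 2)))"
    using fin by (rule exp_sum)
  finally have e: "complex_of_real (exp (- (t\<^sup>2 / 2)))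
      = (\<Prod>j\<in>I. complex_of_real (exp (- (p j * (1 - p j) * s\<^sup>2 / 2))))"
    by simp
  have v: "0 \<le> p j * (1 - p j)" if "j \<in> I" for j using p[OF that] by simp
  have "norm (std_char I p t - complex_of_real (exp (- (t\<^sup>2 / 2))))
      \<le> (\<Sum>j\<in>I. norm (centred_char (p j) s - complex_of_real (exp (- (p j * (1 - p j) * s\<^sup>2 / 2)))))"
    unfolding std_char_def s_def[symmetric] e
  proof (rule norm_prod_diff)
    fix j assume j: "j \<in> I"
    have "0 \<le> p j * (1 - p j) * (1 - cos s)" using v[OF j] by simp
    then show "norm (centred_char (p j) s) \<le> 1"
      by (intro order.trans[OF norm_centred_char_le]) simp
    show "norm (complex_of_real (exp (- (p j * (1 - p j) * s\<^sup>2 / 2)))) \<le> 1"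
      using v[OF j] by simp
  qed
  also have "\<dots> \<le> (\<Sum>j\<in>I. p j * (1 - p j) * (\<bar>s\<bar> ^ 3 + s ^ 4))"
    using p by (intro sum_mono centred_char_approx) auto
  also have "\<dots> = ?\<sigma>\<^sup>2 * (\<bar>s\<bar> ^ 3 + s ^ 4)"
    by (simp add: bernoulli_sd_square[OF p] sum_distrib_right)
  also have "\<dots> = \<bar>t\<bar> ^ 3 / ?\<sigma> + t ^ 4 / ?\<sigma>\<^sup>2"
    using pos by (simp add: s_def field_simps eval_nat_numeral abs_mult)
  finally show ?thesis .
qed

text \<open>The values c = 3 and c = 1 give the majorant exp(-t^2 / 18) and the limit exp(-t^2 /
  2).\<close>

lemma integrable_gaussian: "0 < c \<Longrightarrow> integrable lborel (\<lambda>t::real. exp (- (t\<^sup>2 / (2 * c\<^sup>2))))"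
proof -
  assume c: "0 < c"
  have "integrable lborel (\<lambda>t. sqrt (2 * pi * c\<^sup>2) * normal_density 0 c t)"
    using c by (intro integrable_mult_right integrable_normal_density) auto
  then show ?thesis using c by (simp add: normal_density_def)
qed

text \<open>For fixed t the cut-off eventually lies beyond |t|, and the remaining error is a sum of
  negative powers of \<sigma> with coefficients depending on t only.\<close>

lemma trunc_char_tendsto:
  fixes I :: "nat \<Rightarrow> 'a set" and p :: "nat \<Rightarrow> 'a \<Rightarrow> real"
  assumes p: "\<And>n j. j \<in> I n \<Longrightarrow> 0 \<le> p n j \<and> p n j \<le> 1" and fin: "\<And>n. finite (I n)"
    and lim: "filterlim (\<lambda>n. bernoulli_sd (I n) (p n)) at_top sequentially"
  shows "(\<lambda>n. trunc_char (I n) (p n) t) \<longlonglongrightarrow> complex_of_real (exp (- (t\<^sup>2 / 2)))"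
proof (rule LIM_zero_cancel, rule Lim_null_comparison)
  let ?\<sigma> = "\<lambda>n. bernoulli_sd (I n) (p n)"
  have "\<forall>\<^sub>F n in sequentially. ?\<sigma> n \<ge> \<bar>t\<bar> + 1"
    using lim by (simp add: filterlim_at_top)
  then show "\<forall>\<^sub>F n in sequentially. norm (trunc_char (I n) (p n) t - complex_of_real (exp (- (t\<^sup>2 / 2))))
     \<le> \<bar>t\<bar> ^ 3 / ?\<sigma> n + t ^ 4 / (?\<sigma> n)\<^sup>2"
  proof eventually_elim
    case (elim n)
    have "1 * ?\<sigma> n \<le> pi * ?\<sigma> n"
      using elim pi_gt3 by (intro mult_right_mono) linarith+
    then have "trunc_char (I n) (p n) t = std_char (I n) (p n) t"
      using elim by (auto simp: trunc_char_def indicator_def)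
    then show ?case
      using std_char_approx[of "I n" "p n" t] p fin elim by auto
  qed
  show "(\<lambda>n. \<bar>t\<bar> ^ 3 / ?\<sigma> n + t ^ 4 / (?\<sigma> n)\<^sup>2) \<longlonglongrightarrow> 0"
    by (intro tendsto_add_zero real_tendsto_divide_at_top[OF tendsto_const]
        filterlim_pow_at_top lim) auto
qed

lemma trunc_char_L1_tendsto:
  fixes I :: "nat \<Rightarrow> 'a set" and p :: "nat \<Rightarrow> 'a \<Rightarrow> real"
  assumes p: "\<And>n j. j \<in> I n \<Longrightarrow> 0 \<le> p n j \<and> p n j \<le> 1" and fin: "\<And>n. finite (I n)"
    and lim: "filterlim (\<lambda>n. bernoulli_sd (I n) (p n)) at_top sequentially"
  shows "(\<lambda>n. LINT t|lborel. norm (trunc_char (I n) (p n) t - complex_of_real (exp (- (t\<^sup>2 / 2)))))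
     \<longlonglongrightarrow> 0"
proof -
  let ?d = "\<lambda>n t. norm (trunc_char (I n) (p n) t - complex_of_real (exp (- (t\<^sup>2 / 2))))"
  let ?w = "\<lambda>t::real. exp (- (t\<^sup>2 / 18)) + exp (- (t\<^sup>2 / 2))"
  have "\<forall>\<^sub>F n in sequentially. bernoulli_sd (I n) (p n) > 0"
    using lim by (simp add: filterlim_at_top_dense)
  then obtain N where N: "bernoulli_sd (I n) (p n) > 0" if "n \<ge> N" for n
    by (auto simp: eventually_sequentially)
  \<comment> \<open>The majorant is available only for positive \<sigma>, hence the shift by
    N.\<close>
  have "(\<lambda>n. LINT t|lborel. ?d (n + N) t) \<longlonglongrightarrow> (LINT (t::real)|lborel. 0 :: real)"
  proof (rule integral_dominated_convergence[where w = ?w])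
    show "integrable lborel ?w"
      using integrable_gaussian[of 3] integrable_gaussian[of 1] by simp
    show "AE t in lborel. (\<lambda>n. ?d (n + N) t) \<longlonglongrightarrow> 0"
    proof (intro AE_I2)
      fix t
      show "(\<lambda>n. ?d (n + N) t) \<longlonglongrightarrow> 0"
        by (intro LIMSEQ_ignore_initial_segment tendsto_norm_zero LIM_zero trunc_char_tendsto assms)
    qed
    show "AE t in lborel. norm (?d (n + N) t) \<le> ?w t" for n
    proof (intro AE_I2)
      fix t
      have "?d (n + N) t \<le> norm (trunc_char (I (n + N)) (p (n + N)) t)
          + norm (complex_of_real (exp (- (t\<^sup>2 / 2))))"
        by (rule norm_triangle_ineq4)
      also have "\<dots> \<le> ?w t"
        using norm_trunc_char_le[of "I (n + N)" "p (n + N)" t] p N[of "n + N"] by simp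
      finally show "norm (?d (n + N) t) \<le> ?w t" by simp
    qed
  qed measurable
  then have "(\<lambda>n. LINT t|lborel. ?d (n + N) t) \<longlonglongrightarrow> 0" by simp
  then show ?thesis by (rule LIMSEQ_offset)
qed

section \<open>Fourier inversion for the coefficients\<close>

lemma integral_iexp_period:
  fixes m :: int and \<sigma> :: real
  assumes "\<sigma> > 0"
  shows "(LINT t|lborel. indicator {- (pi * \<sigma>)..pi * \<sigma>} t *\<^sub>R iexp (m * t / \<sigma>))
     = (if m = 0 then 2 * pi * \<sigma> else 0)"
proof (cases "m = 0")
  case True
  then show ?thesis using assms by (simp add: scaleR_conv_of_real)
next
  case False
  let ?F = "\<lambda>t::real. complex_of_real (\<sigma> / m) * (- \<i>) * iexp (m * t / \<sigma>)"
  have "(LINT t|lborel. indicator {- (pi * \<sigma>)..pi * \<sigma>} t *\<^sub>R iexp (m * t / \<sigma>))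
     = ?F (pi * \<sigma>) - ?F (- (pi * \<sigma>))"
  proof (rule integral_FTC_atLeastAtMost)
    show "- (pi * \<sigma>) \<le> pi * \<sigma>" using assms by simp
    show "continuous_on {- (pi * \<sigma>)..pi * \<sigma>} (\<lambda>t. iexp (m * t / \<sigma>))"
      unfolding divide_inverse by (intro continuous_intros)
    fix t
    define c where "c = m / \<sigma>"
    have c: "c \<noteq> 0" using assms False by (simp add: c_def)
    have "((\<lambda>z. complex_of_real (1 / c) * (- \<i>) * exp (\<i> * (complex_of_real c * z)))
        has_field_derivative exp (\<i> * (complex_of_real c * complex_of_real t))) (at (complex_of_real t))"
      using c by (auto intro!: derivative_eq_intros)
    from has_vector_derivative_real_field[OF this]
    have "((\<lambda>t. complex_of_real (1 / c) * (- \<i>) * iexp (c * t)) has_vector_derivative iexp (c * t)) (at t)"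
      by (simp add: mult.assoc)
    then show "(?F has_vector_derivative iexp (m * t / \<sigma>)) (at t within {- (pi * \<sigma>)..pi * \<sigma>})"
      by (simp add: c_def has_vector_derivative_at_within)
  qed
  also have "\<dots> = complex_of_real (\<sigma> / m) * (- \<i>) * (cis (m * pi) - cis (- (m * pi)))"
    using assms by (simp add: cis_conv_exp algebra_simps)
  \<comment> \<open>The cosines agree by symmetry, and the sines vanish because m is an
    integer.\<close>
  also have "cis (m * pi) - cis (- (m * pi)) = 0"
    by (simp add: complex_eq_iff sin_times_pi_eq_0)
  finally show ?thesis using False by simp
qed

lemma poly_of_real_bernoulli_gf:
  fixes z :: complex
  assumes "finite I"
  shows "(\<Prod>j\<in>I. complex_of_real (1 - p j) + complex_of_real (p j) * z)
    = (\<Sum>k\<le>degree (bernoulli_gf I p). complex_of_real (coeff (bernoulli_gf I p) k) * z ^ k)"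
proof -
  have "poly (map_poly complex_of_real (bernoulli_gf I p)) z
     = (\<Prod>j\<in>I. complex_of_real (1 - p j) + complex_of_real (p j) * z)"
    using assms unfolding bernoulli_gf_def
  proof induction
    case (insert j I)
    have "map_poly complex_of_real ([:1 - p j, p j:] * Q)
        = [:complex_of_real (1 - p j), complex_of_real (p j):] * map_poly complex_of_real Q" for Q
      by (rule poly_eqI) (simp add: coeff_map_poly coeff_pCons split: nat.split)
    with insert show ?case by (simp add: algebra_simps)
  qed simp
  then show ?thesis
    by (simp add: poly_altdef coeff_map_poly degree_map_poly)
qed

text \<open>With s = t / \<sigma> the integrand on the cut-off interval is exp(-i k s) P(exp(i s)),
  P being the generating function. Expanding P gives a finite exponential sum, in which
  orthogonality retains only the term with exponent k.\<close>

lemma bernoulli_coeff_fourier: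
  fixes k :: int and p :: "'a \<Rightarrow> real"
  assumes fin: "finite I" and pos: "bernoulli_sd I p > 0"
  defines "x \<equiv> (k - sum p I) / bernoulli_sd I p"
  shows "(LINT t|lborel. iexp (- (x * t)) * trunc_char I p t)
     = complex_of_real (2 * pi * bernoulli_sd I p *
         (if k < 0 then 0 else coeff (bernoulli_gf I p) (nat k)))"
proof -
  let ?\<sigma> = "bernoulli_sd I p" and ?P = "bernoulli_gf I p"
  let ?ind = "\<lambda>t. indicator {- (pi * ?\<sigma>)..pi * ?\<sigma>} t :: real"
  have "iexp (- (x * t)) * trunc_char I p t
      = (\<Sum>j\<le>degree ?P. complex_of_real (coeff ?P j) * (?ind t *\<^sub>R iexp ((int j - k) * t / ?\<sigma>)))" for t :: real
  proof -
    define s where "s = t / ?\<sigma>"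
    have "(\<Sum>j\<le>degree ?P. complex_of_real (coeff ?P j) * iexp s ^ j)
       = (\<Prod>j\<in>I. complex_of_real (1 - p j) + complex_of_real (p j) * iexp s)"
      by (rule poly_of_real_bernoulli_gf[OF fin, symmetric])
    also have "\<dots> = (\<Prod>j\<in>I. iexp (p j * s)) * std_char I p t"
      unfolding centred_char_eq prod.distrib std_char_def s_def ..
    also have "(\<Prod>j\<in>I. iexp (p j * s)) = iexp (sum p I * s)"
      using fin by (simp add: sum_distrib_left sum_distrib_right flip: exp_sum)
    finally have P: "(\<Sum>j\<le>degree ?P. complex_of_real (coeff ?P j) * iexp s ^ j)
       = iexp (sum p I * s) * std_char I p t" .
    have shift: "iexp (- (k * s)) * iexp s ^ j = iexp ((int j - k) * t / ?\<sigma>)" for j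
      by (simp add: s_def algebra_simps diff_divide_distrib flip: exp_of_nat_mult exp_add)
    \<comment> \<open>The second factor restores exactly the mean that centring removed.\<close>
    have "iexp (- (x * t)) = iexp (- (k * s)) * iexp (sum p I * s)"
      by (simp add: s_def x_def algebra_simps diff_divide_distrib flip: exp_add)
    then have "iexp (- (x * t)) * std_char I p t
       = iexp (- (k * s)) * (\<Sum>j\<le>degree ?P. complex_of_real (coeff ?P j) * iexp s ^ j)"
      unfolding P by (simp only: mult.assoc)
    also have "\<dots> = (\<Sum>j\<le>degree ?P. complex_of_real (coeff ?P j) * iexp ((int j - k) * t / ?\<sigma>))"
      unfolding sum_distrib_left shift[symmetric] by (simp only: mult.left_commute)
    finally have "iexp (- (x * t)) * std_char I p t =
       (\<Sum>j\<le>degree ?P. complex_of_real (coeff ?P j) * iexp ((int j - k) * t / ?\<sigma>))" .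
    then show ?thesis
      unfolding trunc_char_def by (simp add: scaleR_sum_right)
  qed
  then have "(LINT t|lborel. iexp (- (x * t)) * trunc_char I p t)
      = (LINT t|lborel. (\<Sum>j\<le>degree ?P. complex_of_real (coeff ?P j) * (?ind t *\<^sub>R iexp ((int j - k) * t / ?\<sigma>))))"
    by (simp only:)
  also have "\<dots> = (\<Sum>j\<le>degree ?P. complex_of_real (coeff ?P j) *
       (LINT t|lborel. ?ind t *\<^sub>R iexp ((int j - k) * t / ?\<sigma>)))"
  proof (subst Bochner_Integration.integral_sum)
    fix j
    show "integrable lborel (\<lambda>t. complex_of_real (coeff ?P j) * (?ind t *\<^sub>R iexp ((int j - k) * t / ?\<sigma>)))"
      unfolding divide_inverse
      by (intro integrable_mult_right borel_integrable_compact compact_Icc continuous_intros)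
  qed (simp only: integral_mult_right_zero)
  also have "\<dots> = (\<Sum>j\<le>degree ?P. if int j = k then complex_of_real (2 * pi * ?\<sigma> * coeff ?P j) else 0)"
    unfolding integral_iexp_period[OF pos] by (intro sum.cong) auto
  also have "\<dots> = complex_of_real (2 * pi * ?\<sigma> * (if k < 0 then 0 else coeff ?P (nat k)))"
  \<comment> \<open>No index matches a negative k or a k beyond the degree; in the latter case the
    coefficient is 0 as well.\<close>
  proof (cases "k < 0")
    case False
    then have "int j = k \<longleftrightarrow> j = nat k" for j by auto
    then show ?thesis using False by (auto simp: coeff_eq_0)
  qed auto
  finally show ?thesis .
qed

text \<open>The known characteristic function of the standard normal distribution, with its
  normalising constant moved across.\<close>

lemma gaussian_fourier:
  "integrable lborel (\<lambda>t. iexp (- (x * t)) * complex_of_real (exp (- (t\<^sup>2 / 2))))"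
  "(LINT t|lborel. iexp (- (x * t)) * complex_of_real (exp (- (t\<^sup>2 / 2))))
     = complex_of_real (2 * pi * std_normal_density x)"
proof -
  show "integrable lborel (\<lambda>t. iexp (- (x * t)) * complex_of_real (exp (- (t\<^sup>2 / 2))))"
    by (rule Bochner_Integration.integrable_bound[OF integrable_gaussian[of 1]]) (simp_all add: norm_mult)
  have "complex_of_real (exp (- (x\<^sup>2) / 2)) = (LINT t|std_normal_distribution. iexp (- x * t))"
    using fun_cong[OF char_std_normal_distribution, of "- x"] by (simp add: char_def)
  also have "\<dots> = (LINT t|lborel. std_normal_density t *\<^sub>R iexp (- x * t))"
    by (rule integral_density) auto
  also have "\<dots> = (LINT t|lborel. complex_of_real (1 / sqrt (2 * pi)) *
      (iexp (- (x * t)) * complex_of_real (exp (- (t\<^sup>2 / 2)))))"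
    by (intro Bochner_Integration.integral_cong) (simp_all add: std_normal_density_def scaleR_conv_of_real)
  also have "\<dots> = complex_of_real (1 / sqrt (2 * pi)) *
      (LINT t|lborel. iexp (- (x * t)) * complex_of_real (exp (- (t\<^sup>2 / 2))))"
    by (rule integral_mult_right_zero)
  finally have "complex_of_real (sqrt (2 * pi)) * complex_of_real (exp (- (x\<^sup>2) / 2))
     = (LINT t|lborel. iexp (- (x * t)) * complex_of_real (exp (- (t\<^sup>2 / 2))))"
    by (simp flip: of_real_mult)
  moreover have "2 * pi * std_normal_density x = sqrt (2 * pi) * exp (- (x\<^sup>2) / 2)"
    using real_sqrt_mult_self[of "2 * pi"] by (simp add: std_normal_density_def field_simps)
  ultimately show "(LINT t|lborel. iexp (- (x * t)) * complex_of_real (exp (- (t\<^sup>2 / 2))))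
     = complex_of_real (2 * pi * std_normal_density x)"
    by simp
qed

text \<open>The two inversion integrals are subtracted; the kernel has modulus 1, so k disappears
  from the bound. This is the source of uniformity.\<close>

lemma bernoulli_local_limit_bound:
  fixes k :: int and p :: "'a \<Rightarrow> real"
  assumes p: "\<And>j. j \<in> I \<Longrightarrow> 0 \<le> p j \<and> p j \<le> 1" and fin: "finite I"
    and pos: "bernoulli_sd I p > 0"
  shows "\<bar>bernoulli_sd I p * (if k < 0 then 0 else coeff (bernoulli_gf I p) (nat k))
      - std_normal_density ((k - sum p I) / bernoulli_sd I p)\<bar>
    \<le> (LINT t|lborel. norm (trunc_char I p t - complex_of_real (exp (- (t\<^sup>2 / 2)))))"
    (is "\<bar>?c - std_normal_density ?x\<bar> \<le> ?J")
proof -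
  have int: "integrable lborel (\<lambda>t. iexp (- (?x * t)) * trunc_char I p t)"
    by (rule Bochner_Integration.integrable_bound[OF integrable_gaussian[of 3]])
       (simp_all add: norm_mult norm_trunc_char_le[OF p pos])
  have "complex_of_real (2 * pi * (?c - std_normal_density ?x))
      = (LINT t|lborel. iexp (- (?x * t)) * trunc_char I p t)
       - (LINT t|lborel. iexp (- (?x * t)) * complex_of_real (exp (- (t\<^sup>2 / 2))))"
    unfolding bernoulli_coeff_fourier[OF fin pos] gaussian_fourier(2) by (simp add: algebra_simps)
  also have "\<dots> = (LINT t|lborel. iexp (- (?x * t)) * (trunc_char I p t - complex_of_real (exp (- (t\<^sup>2 / 2)))))"
    unfolding right_diff_distrib by (rule Bochner_Integration.integral_diff[OF int gaussian_fourier(1), symmetric])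
  finally have "norm (complex_of_real (2 * pi * (?c - std_normal_density ?x)))
     \<le> (LINT t|lborel. norm (iexp (- (?x * t)) * (trunc_char I p t - complex_of_real (exp (- (t\<^sup>2 / 2))))))"
    by (simp only: integral_norm_bound)
  also have "\<dots> = ?J" by (simp add: norm_mult)
  finally have "2 * pi * \<bar>?c - std_normal_density ?x\<bar> \<le> ?J"
    by (simp only: norm_of_real abs_mult) simp
  moreover have "1 * \<bar>?c - std_normal_density ?x\<bar> \<le> 2 * pi * \<bar>?c - std_normal_density ?x\<bar>"
    using pi_gt3 by (intro mult_right_mono) auto
  ultimately show ?thesis by simp
qed

text \<open>The derivative is bounded by 1, since |z| <= 1 + z^2 / 2 <= exp(z^2 / 2). It permits
  replacing the standardised lattice point by x itself.\<close>

lemma std_normal_density_lipschitz: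
  "\<bar>std_normal_density x - std_normal_density y\<bar> \<le> \<bar>x - y\<bar>"
proof -
  have *: "\<bar>std_normal_density b - std_normal_density a\<bar> \<le> b - a" if "a < b" for a b :: real
  proof -
    have "DERIV std_normal_density z :> - (z * exp (- z\<^sup>2 / 2)) / sqrt (2 * pi)" for z
    proof -
      have "DERIV (\<lambda>z. 1 / sqrt (2 * pi) * exp (- z\<^sup>2 / 2)) z
          :> 1 / sqrt (2 * pi) * (exp (- z\<^sup>2 / 2) * (- (2 * z) / 2))"
        by (rule derivative_eq_intros refl | simp)+
      then show ?thesis
        unfolding std_normal_density_def by (simp add: mult.commute)
    qed
    from MVT2[OF that this] obtain z where
      z: "std_normal_density b - std_normal_density a = (b - a) * (- (z * exp (- z\<^sup>2 / 2)) / sqrt (2 * pi))"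
      by auto
    have "\<bar>z\<bar> \<le> 1 + z\<^sup>2 / 2"
      using zero_le_power2[of "\<bar>z\<bar> - 1"] by (simp add: power2_diff)
    also have "\<dots> \<le> exp (z\<^sup>2 / 2)" by (rule exp_ge_add_one_self)
    finally have "\<bar>z * exp (- z\<^sup>2 / 2)\<bar> \<le> 1"
      by (simp add: abs_mult exp_minus field_simps)
    also have "1 \<le> sqrt (2 * pi)" using pi_gt3 by simp
    finally have "\<bar>- (z * exp (- z\<^sup>2 / 2)) / sqrt (2 * pi)\<bar> \<le> 1"
      by simp
    then have "\<bar>b - a\<bar> * \<bar>- (z * exp (- z\<^sup>2 / 2)) / sqrt (2 * pi)\<bar> \<le> \<bar>b - a\<bar> * 1"
      by (rule mult_left_mono) simp
    then show ?thesis
      unfolding z abs_mult using that by simp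
  qed
  show ?thesis
    using *[of x y] *[of y x] by (cases x y rule: linorder_cases) (auto simp: abs_minus_commute)
qed

section \<open>The polynomials \<open>L\<^bsub>n\<^esub>\<close>\<close>

lemma b_poly_0: "b_poly 0 = 0"
  by (simp add: b_poly.simps)

text \<open>The dummy value 0 obeys the halving rule too, so sums may start at index 0 and be split
  by parity.\<close>

lemma b_poly_double: "b_poly (2 * n) = b_poly n"
  by (cases "n = 0") (simp_all add: b_poly_0 b_poly_even)

lemma b_poly_power2: "b_poly (2 ^ n) = 1"
  using b_poly_1 by (induction n) (simp_all add: b_poly_double)

lemma sum_lessThan_double:
  fixes f :: "nat \<Rightarrow> 'a::comm_monoid_add"
  shows "(\<Sum>k<2 * n. f k) = (\<Sum>k<n. f (2 * k)) + (\<Sum>k<n. f (2 * k + 1))"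
  by (induction n) (simp_all add: algebra_simps)

text \<open>The odd-index half of the sum in \<open>L_poly (Suc n)\<close>; with
  \<open>L_poly\<close> it forms a closed first-order linear system.\<close>

definition odd_sum :: "nat \<Rightarrow> int poly" where
  "odd_sum n = (\<Sum>k<2 ^ n. b_poly (2 * k + 1))"

lemma L_poly_lessThan: "L_poly n = 2 * (\<Sum>k<2 ^ n. b_poly k) + 1"
proof -
  have "{..<2 ^ n :: nat} = insert 0 {1..2 ^ n - 1}"
    by (auto simp: set_eq_iff Suc_le_eq)
  then have "(\<Sum>k<2 ^ n. b_poly k) = (\<Sum>k = 1..2 ^ n - 1. b_poly k)"
    by (simp add: b_poly_0)
  then show ?thesis
    by (simp add: L_poly_def b_poly_power2)
qed

lemma L_poly_Suc: "L_poly (Suc n) = L_poly n + 2 * odd_sum n"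
  unfolding L_poly_lessThan odd_sum_def power_Suc sum_lessThan_double b_poly_double
  by (simp add: algebra_simps)

lemma b_poly_odd_pair:
  "b_poly (4 * k + 1) + b_poly (4 * k + 3)
     = 2 * b_poly (2 * k + 1) + [:0, 1:] * (b_poly k + b_poly (Suc k))"
proof (cases "k = 0")
  case True
  show ?thesis
    using True b_poly_4n3[of 0] b_poly_1 b_poly_double[of 1]
    by (simp add: b_poly_0 numeral_2_eq_2)
next
  case False
  have "b_poly (2 * k + 2) = b_poly (Suc k)"
    using b_poly_double[of "Suc k"] by simp
  with False show ?thesis
    by (simp only: b_poly_4n1[of k] b_poly_4n3[of k] b_poly_double) (simp add: algebra_simps)
qed

text \<open>Summing b_k + b_(k+1) over k < 2^n counts every interior term twice and the last term
  b_(2^n) once, which is precisely the shape of \<open>L_poly n\<close>.\<close>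

lemma odd_sum_Suc: "odd_sum (Suc n) = 2 * odd_sum n + [:0, 1:] * L_poly n"
proof -
  have tel: "(\<Sum>k<N. b_poly (Suc k)) = (\<Sum>k<N. b_poly k) + b_poly N" for N
    by (induction N) (simp_all add: b_poly_0)
  have "odd_sum (Suc n) = (\<Sum>k<2 ^ n. b_poly (4 * k + 1) + b_poly (4 * k + 3))"
    unfolding odd_sum_def power_Suc sum_lessThan_double
    by (simp add: sum.distrib algebra_simps numeral_3_eq_3)
  also have "\<dots> = 2 * odd_sum n + [:0, 1:] * (\<Sum>k<2 ^ n. b_poly k + b_poly (Suc k))"
    by (simp only: b_poly_odd_pair sum.distrib odd_sum_def sum_distrib_left distrib_left add.assoc)
  also have "(\<Sum>k<2 ^ n. b_poly k + b_poly (Suc k)) = L_poly n"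
    by (simp add: sum.distrib tel L_poly_lessThan b_poly_power2)
  finally show ?thesis .
qed

text \<open>Elimination of \<open>odd_sum\<close> from the system, via 4 \<open>odd_sum n\<close> =
  2 (\<open>L_poly (Suc n)\<close> - \<open>L_poly n\<close>).\<close>

lemma L_poly_rec: "L_poly (Suc (Suc n)) = 3 * L_poly (Suc n) + [:-2, 2:] * L_poly n"
proof -
  have *: "[:-2, 2:] = 2 * [:0, 1:] - (2 :: int poly)"
    by (simp add: numeral_poly)
  show ?thesis
    unfolding * L_poly_Suc odd_sum_Suc by algebra
qed

lemma L_poly_0: "L_poly 0 = 1" and L_poly_1: "L_poly (Suc 0) = 3"
  using b_poly_1 by (simp_all add: L_poly_lessThan b_poly_0 numeral_2_eq_2)

section \<open>Explicit zeros and factorisation of the normalised polynomials\<close>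

fun M_poly :: "nat \<Rightarrow> real poly" where
  "M_poly 0 = 1"
| "M_poly (Suc 0) = 1"
| "M_poly (Suc (Suc n)) = M_poly (Suc n) + [:-2/9, 2/9:] * M_poly n"

lemma coeff_M_poly: "coeff (M_poly n) k = real_of_int (coeff (L_poly n) k) / 3 ^ n"
proof (induction n arbitrary: k rule: M_poly.induct)
  case 1
  show ?case by (simp add: L_poly_0)
next
  case 2
  show ?case by (simp add: L_poly_1 numeral_poly coeff_pCons split: nat.splits)
next
  case (3 n)
  have [simp]: "coeff (3 * P) i = 3 * coeff P i" for P :: "int poly" and i
    by (simp add: numeral_poly)
  show ?case
    by (cases k) (simp_all add: L_poly_rec 3 coeff_pCons diff_divide_distrib add_divide_distrib)
qed

lemma degree_M_poly: "degree (M_poly n) = degree (L_poly n)"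
  by (intro degree_cong) (simp add: coeff_M_poly)

lemma degree_M_poly_le: "degree (M_poly n) \<le> n div 2"
proof (induction n rule: M_poly.induct)
  case (3 n)
  have "degree ([:-2/9, 2/9:] * M_poly n) \<le> 1 + n div 2"
    by (rule order.trans[OF degree_mult_le]) (use 3 in simp)
  then show ?case
    using 3 by (auto intro!: degree_add_le)
qed auto

lemma poly_M_poly_1: "poly (M_poly n) 1 = 1"
  by (induction n rule: M_poly.induct) simp_all

text \<open>At this argument 2 (q - 1) / 9 equals -1 / (4 (cos t)^2). After scaling by (2 cos t)^n
  the recurrence is that of the Chebyshev polynomials of the second kind, whose value at cos t is
  sin((n + 1) t) / sin t.\<close>

lemma poly_M_poly_trig:
  assumes "sin t \<noteq> 0" "cos t \<noteq> 0"
  shows "poly (M_poly n) (1 - 9 / (8 * (cos t)\<^sup>2))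
    = sin (real (Suc n) * t) / (sin t * (2 * cos t) ^ n)"
proof (induction n rule: M_poly.induct)
  case 1
  show ?case using assms by simp
next
  case 2
  show ?case using assms by (simp add: sin_double)
next
  case (3 n)
  let ?c = "cos t" and ?s = "\<lambda>k. sin (real k * t)"
  have "?s (Suc (Suc (Suc n))) + ?s (Suc n) = 2 * ?c * ?s (Suc (Suc n))"
  proof -
    have "?s (Suc (Suc (Suc n))) = sin (real (Suc (Suc n)) * t + t)"
      "?s (Suc n) = sin (real (Suc (Suc n)) * t - t)"
      by (simp_all add: algebra_simps)
    then show ?thesis by (simp only: sin_add sin_diff) simp
  qed
  then have rec: "?s (Suc (Suc (Suc n))) = 2 * ?c * ?s (Suc (Suc n)) - ?s (Suc n)"
    by simp
  have "poly (M_poly (Suc (Suc n))) (1 - 9 / (8 * ?c\<^sup>2))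
      = ?s (Suc (Suc n)) / (sin t * (2 * ?c) ^ Suc n)
        - 1 / (4 * ?c\<^sup>2) * (?s (Suc n) / (sin t * (2 * ?c) ^ n))"
  proof -
    have "poly [:-2/9, 2/9:] (1 - 9 / (8 * ?c\<^sup>2)) = - (1 / (4 * ?c\<^sup>2))"
      using assms by (simp add: field_simps)
    then show ?thesis
      unfolding M_poly.simps poly_add poly_mult 3 by simp
  qed
  also have "\<dots> = (2 * ?c * ?s (Suc (Suc n)) - ?s (Suc n)) / (sin t * (2 * ?c) ^ Suc (Suc n))"
    using assms by (simp add: divide_simps power2_eq_square)
  finally show ?case
    by (simp only: rec)
qed

text \<open>A zero r contributes the factor (q - r) / (1 - r) = 1 - p + p q with p = 1 / (1 - r);
  this is p for r = 1 - 9 / (8 (cos t)^2) and t = pi j / (n + 1).\<close>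

definition succ_prob :: "nat \<Rightarrow> nat \<Rightarrow> real" where
  "succ_prob n j = 8 / 9 * (cos (pi * real j / real (Suc n)))\<^sup>2"

text \<open>Both sides have degree at most n div 2 and agree at n div 2 + 1 points: the zeros r_j,
  and 1, where both take the value 1.\<close>

lemma M_poly_eq_bernoulli_gf: "M_poly n = bernoulli_gf {1..n div 2} (succ_prob n)"
proof -
  define J where "J = {1..n div 2}"
  define \<theta> where "\<theta> j = pi * real j / real (Suc n)" for j
  define r where "r j = 1 - 9 / (8 * (cos (\<theta> j))\<^sup>2)" for j
  \<comment> \<open>The range of j gives 2 j < n + 1, so the angle pi/2 with vanishing cosine is
    excluded also for odd n.\<close>
  have \<theta>: "0 < \<theta> j" "\<theta> j < pi / 2" if "j \<in> J" for j
  proof -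
    have "1 \<le> j" "2 * real j < real (Suc n)" using that by (auto simp: J_def)
    moreover from this have "pi * (2 * real j) < pi * real (Suc n)" by simp
    ultimately show "0 < \<theta> j" "\<theta> j < pi / 2" by (auto simp: \<theta>_def field_simps)
  qed
  have cos_pos: "0 < cos (\<theta> j)" and sin_pos: "0 < sin (\<theta> j)" if "j \<in> J" for j
    using \<theta>[OF that] by (auto intro!: cos_gt_zero_pi sin_gt_zero)
  have inj: "inj_on r J"
  proof (rule inj_onI)
    fix i j assume ij: "i \<in> J" "j \<in> J" "r i = r j"
    then have "(cos (\<theta> i))\<^sup>2 = (cos (\<theta> j))\<^sup>2"
      using cos_pos[OF ij(1)] cos_pos[OF ij(2)] by (simp add: r_def frac_eq_eq)
    then have "cos (\<theta> i) = cos (\<theta> j)"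
      using cos_pos[OF ij(1)] cos_pos[OF ij(2)] by (simp add: less_imp_le)
    then have "\<theta> i = \<theta> j"
      using \<theta>[OF ij(1)] \<theta>[OF ij(2)] pi_gt_zero by - (rule cos_inj_pi, linarith+)
    then show "i = j" by (simp add: \<theta>_def)
  qed
  have one: "1 \<notin> r ` J"
    using cos_pos by (force simp: r_def)
  have deg: "degree (bernoulli_gf J (succ_prob n)) \<le> n div 2"
  proof -
    have "degree (bernoulli_gf J (succ_prob n)) \<le> (\<Sum>j\<in>J. degree [:1 - succ_prob n j, succ_prob n j:])"
      unfolding bernoulli_gf_def
      by (rule order.trans[OF degree_prod_sum_le]) (simp_all add: J_def o_def)
    also have "\<dots> \<le> (\<Sum>j\<in>J. 1)" by (intro sum_mono) simp
    finally show ?thesis by (simp add: J_def)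
  qed
  have card: "card (insert 1 (r ` J)) = Suc (n div 2)"
    using inj one by (simp add: card_image J_def)
  have "poly (M_poly n) x = poly (bernoulli_gf J (succ_prob n)) x" if x: "x \<in> insert 1 (r ` J)" for x
  proof (cases "x = 1")
    case True
    then show ?thesis by (simp add: poly_M_poly_1 bernoulli_gf_def poly_prod)
  next
    case False
    with x obtain j where j: "j \<in> J" "x = r j" by auto
    have "sin (real (Suc n) * \<theta> j) = sin (pi * real j)" by (simp add: \<theta>_def)
    then have "poly (M_poly n) x = 0"
      using poly_M_poly_trig[of "\<theta> j" n] cos_pos[OF j(1)] sin_pos[OF j(1)] by (simp add: j r_def)
    moreover have "poly [:1 - succ_prob n j, succ_prob n j:] x = 0"
      using cos_pos[OF j(1)] by (simp add: j r_def succ_prob_def \<theta>_def field_simps)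
    then have "poly (bernoulli_gf J (succ_prob n)) x = 0"
      unfolding bernoulli_gf_def poly_prod using j by (intro prod_zero) (auto simp: J_def)
    ultimately show ?thesis by simp
  qed
  moreover have "degree (M_poly n) < card (insert 1 (r ` J))"
    "degree (bernoulli_gf J (succ_prob n)) < card (insert 1 (r ` J))"
    unfolding card using deg degree_M_poly_le[of n] by simp_all
  ultimately show ?thesis
    unfolding J_def[symmetric] by (rule poly_eqI_degree)
qed

section \<open>Mean and variance from derivatives at 1\<close>

lemma poly_eq_sum_le:
  fixes P :: "'a::comm_semiring_1 poly"
  assumes "degree P \<le> N"
  shows "poly P x = (\<Sum>k\<le>N. coeff P k * x ^ k)"
  unfolding poly_altdef using assms by (intro sum.mono_neutral_left) (auto simp: coeff_eq_0)

lemma sum_coeff_times: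
  fixes P :: "real poly"
  assumes "degree P \<le> N"
  shows "(\<Sum>k\<le>N. coeff P k * real k) = poly (pderiv P) 1"
proof -
  have "degree (pderiv P) \<le> N"
    using assms by (simp add: degree_pderiv)
  then have "poly (pderiv P) 1 = (\<Sum>k\<le>N. coeff (pderiv P) k)"
    by (simp add: poly_eq_sum_le)
  also have "\<dots> = (\<Sum>k\<le>N. coeff P (Suc k) * real (Suc k))"
    by (simp add: coeff_pderiv mult.commute)
  also have "\<dots> = (\<Sum>k\<le>Suc N. coeff P k * real k)"
    by (subst sum.atMost_Suc_shift) simp
  also have "\<dots> = (\<Sum>k\<le>N. coeff P k * real k)"
    using assms by (simp add: coeff_eq_0)
  finally show ?thesis ..
qed

text \<open>The first-moment formula applied to q P'(q), whose coefficients are k a_k and whose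
  derivative is P' + q P''.\<close>

lemma sum_coeff_times_square:
  fixes P :: "real poly"
  assumes "degree P \<le> N"
  shows "(\<Sum>k\<le>N. coeff P k * (real k)\<^sup>2) = poly (pderiv P) 1 + poly (pderiv (pderiv P)) 1"
proof -
  let ?Q = "pCons 0 (pderiv P)"
  have c: "coeff ?Q k = coeff P k * real k" for k
    by (cases k) (simp_all add: coeff_pderiv)
  have "degree ?Q \<le> N"
    using assms by (intro degree_le) (auto simp: c coeff_eq_0)
  from sum_coeff_times[OF this] show ?thesis
    unfolding c by (simp add: pderiv_pCons power2_eq_square mult.assoc)
qed

text \<open>One induction yields all three, since the product rule for each derivative brings in the
  lower ones.\<close>

lemma bernoulli_gf_moments:
  assumes "finite I"
  shows "poly (bernoulli_gf I p) 1 = 1"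
    and "poly (pderiv (bernoulli_gf I p)) 1 = sum p I"
    and "poly (pderiv (pderiv (bernoulli_gf I p))) 1
           = (sum p I)\<^sup>2 - (\<Sum>j\<in>I. (p j)\<^sup>2)"
  using assms unfolding bernoulli_gf_def
  by (induction I)
     (simp_all add: pderiv_mult pderiv_pCons pderiv_add pderiv_smult algebra_simps power2_eq_square)

lemma sum_int_interval: "(\<Sum>k = 0..int N. f k) = (\<Sum>k\<le>N. f (int k))"
  by (rule sum.reindex_bij_witness[of _ int nat]) auto

lemma L_prob_eq:
  "L_prob n k = (if k < 0 then 0 else coeff (M_poly n) (nat k))"
proof -
  \<comment> \<open>The normalising total is L_n(1) = 3^n.\<close>
  have "real_of_int (\<Sum>j = 0..int (degree (L_poly n)). L_coeff n j)
     = 3 ^ n * (\<Sum>k\<le>degree (M_poly n). coeff (M_poly n) k)"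
    by (simp add: sum_int_interval L_coeff_def coeff_M_poly degree_M_poly flip: sum_divide_distrib)
  also have "(\<Sum>k\<le>degree (M_poly n). coeff (M_poly n) k) = poly (M_poly n) 1"
    by (simp add: poly_altdef)
  finally show ?thesis
    by (simp add: L_prob_def L_coeff_def coeff_M_poly poly_M_poly_1)
qed

lemma L_mean_eq: "L_mean n = (\<Sum>j = 1..n div 2. succ_prob n j)"
proof -
  have "L_mean n = (\<Sum>k\<le>degree (M_poly n). coeff (M_poly n) k * real k)"
    by (simp add: L_mean_def sum_int_interval L_prob_eq degree_M_poly mult.commute)
  also have "\<dots> = poly (pderiv (M_poly n)) 1"
    by (rule sum_coeff_times) simp
  also have "\<dots> = (\<Sum>j = 1..n div 2. succ_prob n j)"
    unfolding M_poly_eq_bernoulli_gf by (rule bernoulli_gf_moments) simp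
  finally show ?thesis .
qed

lemma L_var_eq: "L_var n = (\<Sum>j = 1..n div 2. succ_prob n j * (1 - succ_prob n j))"
proof -
  let ?P = "M_poly n" and ?m = "L_mean n"
  let ?N = "degree ?P"
  note mom = bernoulli_gf_moments[of "{1..n div 2}" "succ_prob n", folded M_poly_eq_bernoulli_gf L_mean_eq]
  have "L_var n = (\<Sum>k\<le>?N. (real k - ?m)\<^sup>2 * coeff ?P k)"
    by (simp add: L_var_def sum_int_interval L_prob_eq degree_M_poly)
  also have "\<dots> = (\<Sum>k\<le>?N. coeff ?P k * (real k)\<^sup>2) - 2 * ?m * (\<Sum>k\<le>?N. coeff ?P k * real k)
       + ?m\<^sup>2 * (\<Sum>k\<le>?N. coeff ?P k)"
    by (simp add: power2_diff algebra_simps sum.distrib sum_subtractf sum_distrib_left)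
  also have "(\<Sum>k\<le>?N. coeff ?P k) = poly ?P 1"
    by (simp add: poly_altdef)
  \<comment> \<open>The second moment is m + m^2 minus the sum of the p_j^2, so the terms in m^2
    cancel.\<close>
  also have "(\<Sum>k\<le>?N. coeff ?P k * (real k)\<^sup>2) - 2 * ?m * (\<Sum>k\<le>?N. coeff ?P k * real k)
       + ?m\<^sup>2 * poly ?P 1 = ?m - (\<Sum>j = 1..n div 2. (succ_prob n j)\<^sup>2)"
    unfolding sum_coeff_times[OF order.refl] sum_coeff_times_square[OF order.refl]
    using mom by (simp add: power2_eq_square algebra_simps)
  finally show ?thesis
    by (simp add: L_mean_eq algebra_simps power2_eq_square sum_subtractf)
qed

lemma succ_prob_bounds: "0 \<le> succ_prob n j" "succ_prob n j \<le> 8 / 9"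
  using abs_square_le_1[of "cos (pi * real j / real (Suc n))"]
  by (auto simp: succ_prob_def)

text \<open>For j <= n/4 the angle is at most pi/4, so p_j >= 4/9, while always 1 - p_j >= 1/9. Each
  such j therefore adds at least 4/81.\<close>

lemma L_var_at_top: "filterlim L_var at_top sequentially"
proof (rule filterlim_at_top_mono)
  show "filterlim (\<lambda>n. 4 / 81 * real (n div 4)) at_top sequentially"
    by (intro filterlim_tendsto_pos_mult_at_top[OF tendsto_const]
        filterlim_compose[OF filterlim_real_sequentially] filterlim_at_top_div_const_nat) auto
  show "\<forall>\<^sub>F n in sequentially. 4 / 81 * real (n div 4) \<le> L_var n"
  proof (intro always_eventually allI)
    fix n
    have "4 / 81 * real (n div 4) = (\<Sum>j = 1..n div 4. 4 / 81)" by simp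
    also have "\<dots> \<le> (\<Sum>j = 1..n div 4. succ_prob n j * (1 - succ_prob n j))"
    proof (intro sum_mono)
      fix j assume "j \<in> {1..n div 4}"
      then have "4 * real j \<le> real n" by auto
      then have "pi * (4 * real j) \<le> pi * real (Suc n)" by (intro mult_left_mono) auto
      then have "pi * real j / real (Suc n) \<le> pi / 4" by (simp add: field_simps)
      then have "cos (pi / 4) \<le> cos (pi * real j / real (Suc n))"
        by (intro cos_monotone_0_pi_le) auto
      then have "(cos (pi / 4))\<^sup>2 \<le> (cos (pi * real j / real (Suc n)))\<^sup>2"
        by (intro power_mono) (auto simp: cos_45)
      then have "4 / 9 \<le> succ_prob n j"
        by (simp add: succ_prob_def cos_45 power_divide)
      then have "4 / 9 * (1 / 9) \<le> succ_prob n j * (1 - succ_prob n j)"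
        using succ_prob_bounds[of n j] by (intro mult_mono) auto
      then show "4 / 81 \<le> succ_prob n j * (1 - succ_prob n j)" by simp
    qed
    also have "\<dots> \<le> L_var n"
      unfolding L_var_eq
      using succ_prob_bounds order.trans[OF succ_prob_bounds(2)]
      by (intro sum_mono2) auto
    finally show "4 / 81 * real (n div 4) \<le> L_var n" .
  qed
qed

section \<open>Uniform local limit theorem for the coefficients\<close>

theorem theorem4p2:
  "(\<lambda>n. SUP x::real. \<bar>L_sd n * L_prob n \<lfloor>L_mean n + x * L_sd n\<rfloor>
        - 1 / sqrt (2 * pi) * exp (- (x\<^sup>2) / 2)\<bar>) \<longlonglongrightarrow> 0"
proof -
  let ?I = "\<lambda>n. {1..n div 2}"
  let ?f = "\<lambda>n x. \<bar>L_sd n * L_prob n \<lfloor>L_mean n + x * L_sd n\<rfloor>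
        - 1 / sqrt (2 * pi) * exp (- (x\<^sup>2) / 2)\<bar>"
  define B where "B n = (LINT t|lborel. norm (trunc_char (?I n) (succ_prob n) t
      - complex_of_real (exp (- (t\<^sup>2 / 2)))))" for n
  have sd: "L_sd n = bernoulli_sd (?I n) (succ_prob n)" for n
    by (simp add: L_sd_def L_var_eq bernoulli_sd_def)
  have p: "0 \<le> succ_prob n j \<and> succ_prob n j \<le> 1" for n j
    using succ_prob_bounds[of n j] by auto
  have sd_lim: "filterlim L_sd at_top sequentially"
    unfolding L_sd_def using filterlim_compose[OF sqrt_at_top L_var_at_top] by simp
  \<comment> \<open>The error splits into the Fourier bound \<open>B n\<close> at the lattice point
    y and the cost of moving from y to x, where the floor shifts by at most 1 before division by the
    standard deviation.\<close>
  have bound: "?f n x \<le> B n + 1 / L_sd n" if pos: "L_sd n > 0" for n x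
  proof -
    define k where "k = \<lfloor>L_mean n + x * L_sd n\<rfloor>"
    define y where "y = (k - L_mean n) / L_sd n"
    have "\<bar>L_sd n * L_prob n k - std_normal_density y\<bar> \<le> B n"
      using bernoulli_local_limit_bound[of "?I n" "succ_prob n" k,
          folded sd M_poly_eq_bernoulli_gf L_mean_eq L_prob_eq B_def] p pos
      by (simp add: y_def)
    moreover have "\<bar>y - x\<bar> \<le> 1 / L_sd n"
    proof -
      have "y - x = (k - (L_mean n + x * L_sd n)) / L_sd n"
        using pos by (simp add: y_def field_simps)
      moreover have "\<bar>k - (L_mean n + x * L_sd n)\<bar> \<le> 1"
        unfolding k_def by linarith
      ultimately show ?thesis
        using pos by (simp add: divide_right_mono)
    qed
    ultimately have "\<bar>L_sd n * L_prob n k - std_normal_density x\<bar> \<le> B n + 1 / L_sd n"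
      using std_normal_density_lipschitz[of y x] by linarith
    then show ?thesis
      by (simp add: k_def std_normal_density_def)
  qed
  have "\<forall>\<^sub>F n in sequentially. L_sd n > 0"
    using sd_lim by (simp add: filterlim_at_top_dense)
  then have "\<forall>\<^sub>F n in sequentially. norm (SUP x. ?f n x) \<le> B n + 1 / L_sd n"
  proof eventually_elim
    case (elim n)
    have "(SUP x. ?f n x) \<le> B n + 1 / L_sd n"
      by (intro cSUP_least bound elim) simp
    \<comment> \<open>A real supremum dominates its members only for sets bounded above; the uniform
      bound supplies this, and the value at x = 0 shows that the supremum is nonnegative.\<close>
    moreover have "?f n 0 \<le> (SUP x. ?f n x)"
      by (intro cSUP_upper bdd_aboveI2[where M = "B n + 1 / L_sd n"] bound elim) simp
    then have "0 \<le> (SUP x. ?f n x)"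
      by (rule order.trans[OF abs_ge_zero])
    ultimately show ?case by simp
  qed
  moreover have "(\<lambda>n. B n + 1 / L_sd n) \<longlonglongrightarrow> 0"
  proof (rule tendsto_add_zero)
    show "B \<longlonglongrightarrow> 0"
      unfolding B_def using p sd_lim
      by (intro trunc_char_L1_tendsto) (simp_all only: sd[abs_def] finite_atLeastAtMost)
    show "(\<lambda>n. 1 / L_sd n) \<longlonglongrightarrow> 0"
      by (rule real_tendsto_divide_at_top[OF tendsto_const sd_lim])
  qed
  ultimately show ?thesis
    by (rule Lim_null_comparison)
qed

end
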